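(* Let $m\ge 1$ and $d\ge 2$ be integers, let $X$ be an $m\times d$ real matrix with pairwise distinct rows $\mathbf{x}_1^T,\ldots,\mathbf{x}_m^T$, and let $w_1,\ldots,w_m>0$ be fixed real numbers. For an allocation $\mathbf{p}=(p_1,\ldots,p_m)'$ (with $p_i\ge 0$ and $\sum_{i=1}^m p_i=1$) let $f(\mathbf{p})=|X'WX|$ with $W=\mathrm{diag}(p_1w_1,\ldots,p_mw_m)$, and let $f_i$ be the one-variable functions associated with $\mathbf{p}$ defined in the context. Suppose $f(\mathbf{p})>0$. Then $\mathbf{p}$ is D-optimal if and only if for each $i=1,\ldots,m$, one of the two conditions below is satisfied: (i) $p_i=0$ and $f_i\left(\frac12\right)\le \frac{d+1}{2^d}\,f(\mathbf{p})$; (ii) $0<p_i\le \frac1d$ and $f_i(0)=\frac{1-p_i d}{(1-p_i)^d}\,f(\mathbf{p})$.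
   Context: Setting: in a generalized linear model with $m$ distinct design points $\mathbf{x}_1,\ldots,\mathbf{x}_m\in\mathbb{R}^d$, a single-parameter exponential family response, link function $g$, and linear predictors $\eta_i=\mathbf{x}_i^T\boldsymbol\beta$, the numbers $w_i=\frac{1}{\mathrm{var}(Y_i)}\left(\frac{\partial\mu_i}{\partial\eta_i}\right)^2$ (where $\mu_i=E(Y_i)$) are treated as known positive constants (local optimality). The Fisher information matrix is $nX'WX$, where $X=(\mathbf{x}_1,\ldots,\mathbf{x}_m)^T$ and $W=\mathrm{diag}(p_1w_1,\ldots,p_mw_m)$. Only the positivity of the constants $w_i$ and the matrix $X$ enter the claim. Notation: $|\cdot|$ is the determinant and $'$ denotes transpose. An allocation (approximate design) is a vector $\mathbf{p}=(p_1,\ldots,p_m)'$ with $p_i\ge 0$ for all $i$ and $p_1+\cdots+p_m=1$. An allocation is (locally) D-optimal if it maximizes $f(\mathbf{p})=|X'WX|$ over all allocations. For an allocation $\mathbf{p}$ with $f(\mathbf{p})>0$ (so that $p_i<1$ for every $i$, since $d\ge2$) and $i=1,\ldots,m$, define for $0\le z\le 1$ $$f_i(z)=f\left(\frac{1-z}{1-p_i}p_1,\ldots,\frac{1-z}{1-p_i}p_{i-1},\,z,\,\frac{1-z}{1-p_i}p_{i+1},\ldots,\frac{1-z}{1-p_i}p_m\right).$$ *)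

theory Defs
  imports "HOL-Analysis.Analysis"
begin

text \<open>Design points are the rows of \<open>X :: real^'d^'m\<close>, so \<open>m = CARD('m)\<close> and \<open>d = CARD('d)\<close>.\<close>

definition allocation :: "real^'m \<Rightarrow> bool" where
  "allocation p \<longleftrightarrow> (\<forall>i. 0 \<le> p $ i) \<and> (\<Sum>i\<in>UNIV. p $ i) = 1"

definition diag :: "('m \<Rightarrow> real) \<Rightarrow> real^'m^'m" where
  "diag c = (\<chi> i j. if i = j then c i else 0)"

definition objective :: "real^'d^'m \<Rightarrow> real^'m \<Rightarrow> real^'m \<Rightarrow> real" where
  "objective X w p = det (transpose X ** diag (\<lambda>i. p $ i * w $ i) ** X)"

definition D_optimal :: "real^'d^'m \<Rightarrow> real^'m \<Rightarrow> real^'m \<Rightarrow> bool" where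
  "D_optimal X w p \<longleftrightarrow>
     allocation p \<and> (\<forall>q. allocation q \<longrightarrow> objective X w q \<le> objective X w p)"

text \<open>Meaningful for \<open>p $ i < 1\<close>, which holds for every allocation with positive objective
  when \<open>d \<ge> 2\<close>, and for \<open>0 \<le> z \<le> 1\<close>.\<close>

definition objective_along :: "real^'d^'m \<Rightarrow> real^'m \<Rightarrow> real^'m \<Rightarrow> 'm \<Rightarrow> real \<Rightarrow> real" where
  "objective_along X w p i z =
     objective X w (\<chi> j. if j = i then z else (1 - z) / (1 - p $ i) * p $ j)"

end

theory Submission
  imports Defs
begin

text \<open>Write \<open>M(p) = X'WX\<close>, \<open>P = M(p)\<^sup>-\<^sup>1\<close> and \<open>v\<^sub>i = w\<^sub>i x\<^sub>i' P x\<^sub>i\<close>, so that \<open>\<Sum> p\<^sub>i v\<^sub>i = tr (P M(p)) = d\<close>.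
  The matrix determinant lemma turns (i) into \<open>v\<^sub>i \<le> d\<close> and (ii) into \<open>v\<^sub>i = d\<close>, while
  \<open>\<Sum> p\<^sub>i (d - v\<^sub>i) = 0\<close> forces \<open>v\<^sub>i = d\<close> wherever \<open>p\<^sub>i > 0\<close> once all \<open>v\<^sub>i \<le> d\<close>. It remains to prove
  the equivalence theorem: \<open>p\<close> is D-optimal iff \<open>v\<^sub>i \<le> d\<close> for all \<open>i\<close>. Necessity is a perturbation
  towards the \<open>i\<close>-th vertex. For sufficiency, compare \<open>p\<close> with a maximizer \<open>q\<close>, which exists by
  compactness and satisfies the same bounds. With \<open>Q = M(q)\<^sup>-\<^sup>1\<close> and \<open>D = M(q) - M(p)\<close>,
  \<open>tr (P D Q D) = tr (P M(q)) + tr (Q M(p)) - 2d \<le> 0\<close>, and positive definiteness of \<open>P\<close> and \<open>Q\<close>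
  then gives \<open>D = 0\<close>, so no spectral theorem or concavity of log det is needed.\<close>

section \<open>Determinants of rank-one updates\<close>

text \<open>An orthogonal map rotates \<open>v\<close> onto a coordinate axis; the rotated matrix differs from the
  identity in one column only, and Cramer's lemma evaluates its determinant.\<close>

lemma det_mat1_add_outer:
  fixes u v :: "real^'n"
  shows "det (mat 1 + (\<chi> i j. u $ i * v $ j)) = 1 + u \<bullet> v"
proof (cases "v = 0")
  case True
  have "(\<chi> i j. u $ i * v $ j) = (0 :: real^'n^'n)"
    by (simp add: True vec_eq_iff)
  with True show ?thesis by simp
next
  case False
  obtain k :: 'n where True by blast
  define e :: "real^'n" where "e = norm v *\<^sub>R axis k 1"
  obtain f where f: "orthogonal_transformation f" "f v = e"
    using orthogonal_transformation_exists[of v e] by (auto simp: e_def)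
  define T where "T = matrix f"
  have T: "T *v x = f x" for x
    using f(1) by (simp add: T_def orthogonal_transformation_def matrix_works)
  have orth: "orthogonal_matrix T"
    using f(1) by (simp add: T_def orthogonal_transformation_matrix)
  have inner: "f x \<bullet> f y = x \<bullet> y" for x y
    using f(1) by (simp add: orthogonal_transformation_def)
  define z where "z = T *v u"
  \<comment> \<open>\<open>R\<close> is the rotated matrix I + norm v * z e_k', and \<open>y\<close>
    is its \<open>k\<close>-th column, the only one that differs from the identity.\<close>
  define y where "y = axis k 1 + norm v *\<^sub>R z"
  define R where "R = (\<chi> i j. if j = k then y $ i else mat 1 $ i $ j)"
  have apply_outer: "(mat 1 + (\<chi> i j. u $ i * v $ j)) *v x = x + (v \<bullet> x) *\<^sub>R u" for x :: "real^'n"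
    by (simp add: matrix_vector_mult_add_rdistrib)
       (simp add: vec_eq_iff matrix_vector_mult_def inner_vec_def sum_distrib_left mult_ac)
  have R: "R *v x = x + (norm v * x $ k) *\<^sub>R z" for x
  proof -
    have "(R *v x) $ i = x $ i + (norm v * x $ k) * z $ i" for i
    proof -
      have "(R *v x) $ i = (\<Sum>j\<in>UNIV. mat 1 $ i $ j * x $ j + (if j = k then norm v * z $ i * x $ k else 0))"
        unfolding R_def matrix_vector_mult_def
        by (auto intro!: sum.cong simp: y_def mat_def axis_def algebra_simps simp flip: matrix_vector_mult_def)
      also have "\<dots> = (mat 1 *v x) $ i + norm v * z $ i * x $ k"
        unfolding matrix_vector_mult_def[of "mat 1"] by (simp add: sum.distrib)
      finally show ?thesis by simp
    qed
    then show ?thesis by (simp add: vec_eq_iff)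
  qed
  have "T ** (mat 1 + (\<chi> i j. u $ i * v $ j)) = R ** T"
  proof -
    have "T *v ((mat 1 + (\<chi> i j. u $ i * v $ j)) *v x) = R *v (T *v x)" for x
    proof -
      have "norm v * (T *v x) $ k = e \<bullet> f x"
        by (simp add: e_def T inner_axis')
      also have "\<dots> = v \<bullet> x" by (metis f(2) inner)
      finally show ?thesis
        unfolding apply_outer R by (simp add: z_def matrix_vector_right_distrib matrix_vector_mult_scaleR)
    qed
    then show ?thesis by (simp add: matrix_eq matrix_vector_mul_assoc)
  qed
  then have "det T * det (mat 1 + (\<chi> i j. u $ i * v $ j)) = det R * det T"
    by (metis det_mul)
  moreover have "det T \<noteq> 0"
    using det_orthogonal_matrix[OF orth] by auto
  moreover have "det R = 1 + u \<bullet> v"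
  proof -
    have "det R = y $ k"
      using cramer_lemma[of k "mat 1" y, unfolded matrix_vector_mul_lid] by (simp add: R_def)
    also have "\<dots> = 1 + f u \<bullet> e"
      by (simp add: y_def z_def e_def T inner_axis)
    also have "\<dots> = 1 + u \<bullet> v" by (metis f(2) inner)
    finally show ?thesis .
  qed
  ultimately show ?thesis by simp
qed

lemma det_scaleR:
  fixes A :: "real^'n^'n"
  shows "det (c *\<^sub>R A) = c ^ CARD('n) * det A"
proof -
  have "c *\<^sub>R A = (\<chi> i. c *s A $ i)"
    by (simp add: vec_eq_iff)
  then show ?thesis
    by (simp add: det_rows_mul)
qed

text \<open>Factoring out \<open>A\<close> leaves I + y v' with y = P u, the case already
  settled.\<close>

lemma det_add_outer:
  fixes A P :: "real^'n^'n"
  assumes "A ** P = mat 1"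
  shows "det (A + (\<chi> a b. u $ a * v $ b)) = det A * (1 + (P *v u) \<bullet> v)"
proof -
  define y where "y = P *v u"
  have "A *v y = u"
    by (simp add: y_def matrix_vector_mul_assoc assms)
  then have u: "u $ a = (\<Sum>k\<in>UNIV. A $ a $ k * y $ k)" for a
    by (auto simp: matrix_vector_mult_def)
  have "A ** (\<chi> a b. y $ a * v $ b) = (\<chi> a b. u $ a * v $ b)"
    by (simp add: vec_eq_iff matrix_matrix_mult_def u sum_distrib_right mult.assoc)
  then have "A + (\<chi> a b. u $ a * v $ b) = A ** (mat 1 + (\<chi> a b. y $ a * v $ b))"
    by (simp add: matrix_add_ldistrib)
  then show ?thesis
    by (simp add: det_mul det_mat1_add_outer y_def)
qed

section \<open>The information matrix, its quadratic form and its inverse\<close>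

definition info_matrix :: "real^'d^'m \<Rightarrow> real^'m \<Rightarrow> real^'m \<Rightarrow> real^'d^'d" where
  "info_matrix X w p = transpose X ** diag (\<lambda>i. p $ i * w $ i) ** X"

lemma objective_eq_det: "objective X w p = det (info_matrix X w p)"
  by (simp add: objective_def info_matrix_def)

lemma info_matrix_component:
  "info_matrix X w p $ a $ b = (\<Sum>j\<in>UNIV. p $ j * w $ j * X $ j $ a * X $ j $ b)"
  unfolding info_matrix_def diag_def matrix_matrix_mult_def transpose_def
  by (auto simp: if_distrib[of "\<lambda>x. _ * x"] cong: if_cong intro!: sum.cong)

lemma info_matrix_mult:
  "info_matrix X w p *v u = (\<Sum>j\<in>UNIV. (p $ j * w $ j * (row j X \<bullet> u)) *\<^sub>R row j X)"
proof -
  have "(info_matrix X w p *v u) $ a = (\<Sum>j\<in>UNIV. (p $ j * w $ j * (row j X \<bullet> u)) * row j X $ a)" for a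
  proof -
    have "(info_matrix X w p *v u) $ a = (\<Sum>b\<in>UNIV. \<Sum>j\<in>UNIV. p $ j * w $ j * X $ j $ a * X $ j $ b * u $ b)"
      by (simp add: matrix_vector_mult_def info_matrix_component sum_distrib_right)
    also have "\<dots> = (\<Sum>j\<in>UNIV. \<Sum>b\<in>UNIV. p $ j * w $ j * X $ j $ a * X $ j $ b * u $ b)"
      by (rule sum.swap)
    finally show ?thesis
      by (simp add: row_def inner_vec_def sum_distrib_left sum_distrib_right mult_ac)
  qed
  then show ?thesis by (simp add: vec_eq_iff)
qed

lemma inner_info_matrix:
  "y \<bullet> (info_matrix X w p *v u) = (\<Sum>j\<in>UNIV. p $ j * w $ j * (row j X \<bullet> y) * (row j X \<bullet> u))"
  by (simp add: info_matrix_mult inner_sum_right inner_commute[of y] mult_ac)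

lemma info_matrix_sym:
  "(info_matrix X w p *v u) \<bullet> y = u \<bullet> (info_matrix X w p *v y)"
  by (subst inner_commute) (simp add: inner_info_matrix mult_ac)

text \<open>M(p) is the sum of the p_j w_j x_j x_j', and tr (K x x') = x' K x. \<open>K\<close>
  stays arbitrary so that the inverse for one design can be paired with the information matrix of
  another.\<close>

lemma trace_mult_info_matrix:
  "trace (K ** info_matrix X w p) = (\<Sum>j\<in>UNIV. p $ j * w $ j * (row j X \<bullet> (K *v row j X)))"
proof -
  have "trace (K ** info_matrix X w p)
      = (\<Sum>a\<in>UNIV. \<Sum>b\<in>UNIV. \<Sum>j\<in>UNIV. p $ j * w $ j * (X $ j $ a * (K $ a $ b * X $ j $ b)))"
    by (simp add: trace_def matrix_matrix_mult_def info_matrix_component sum_distrib_left mult_ac)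
  also have "\<dots> = (\<Sum>a\<in>UNIV. \<Sum>j\<in>UNIV. \<Sum>b\<in>UNIV. p $ j * w $ j * (X $ j $ a * (K $ a $ b * X $ j $ b)))"
    by (intro sum.cong refl sum.swap)
  also have "\<dots> = (\<Sum>j\<in>UNIV. \<Sum>a\<in>UNIV. \<Sum>b\<in>UNIV. p $ j * w $ j * (X $ j $ a * (K $ a $ b * X $ j $ b)))"
    by (rule sum.swap)
  also have "\<dots> = (\<Sum>j\<in>UNIV. p $ j * w $ j * (row j X \<bullet> (K *v row j X)))"
    by (simp add: row_def inner_vec_def matrix_vector_mult_def sum_distrib_left)
  finally show ?thesis .
qed

lemma sum_variance:
  fixes X :: "real^'d^'m"
  assumes "P ** info_matrix X w p = mat 1"
  shows "(\<Sum>j\<in>UNIV. p $ j * (w $ j * (row j X \<bullet> (P *v row j X)))) = real CARD('d)"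
  using trace_mult_info_matrix[of P X w p] by (simp add: assms trace_I mult.assoc)

lemma inverse_info_matrix_sym:
  assumes "info_matrix X w p ** P = mat 1"
  shows "(P *v u) \<bullet> y = u \<bullet> (P *v y)"
proof -
  have "info_matrix X w p *v (P *v x) = x" for x
    by (simp add: matrix_vector_mul_assoc assms)
  then show ?thesis
    by (metis info_matrix_sym)
qed

text \<open>For z = P y one has y = M(p) z, so y' P y = z' M(p) z, a weighted sum of squares.
  Positive definiteness and the bound p_i v_i \<le> 1 are both read off from it.\<close>

lemma inverse_info_matrix_form:
  assumes "info_matrix X w p ** P = mat 1"
  shows "y \<bullet> (P *v y) = (\<Sum>j\<in>UNIV. p $ j * w $ j * (row j X \<bullet> (P *v y))\<^sup>2)"
proof -
  have "y \<bullet> (P *v y) = (P *v y) \<bullet> (info_matrix X w p *v (P *v y))"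
    by (simp add: matrix_vector_mul_assoc assms inner_commute)
  then show ?thesis
    by (simp add: inner_info_matrix power2_eq_square mult.assoc)
qed

lemma inverse_info_matrix_posdef:
  assumes P: "info_matrix X w p ** P = mat 1"
    and nonneg: "\<And>j. 0 \<le> p $ j" "\<And>j. 0 < w $ j"
  shows "0 \<le> y \<bullet> (P *v y)" and "y \<bullet> (P *v y) = 0 \<Longrightarrow> y = 0"
proof -
  have terms: "0 \<le> p $ j * w $ j * (row j X \<bullet> (P *v y))\<^sup>2" for j
    using nonneg[of j] by simp
  then show "0 \<le> y \<bullet> (P *v y)"
    by (simp add: inverse_info_matrix_form[OF P] sum_nonneg)
  assume "y \<bullet> (P *v y) = 0"
  then have "p $ j * w $ j * (row j X \<bullet> (P *v y))\<^sup>2 = 0" for j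
    using terms by (simp add: inverse_info_matrix_form[OF P] sum_nonneg_eq_0_iff)
  \<comment> \<open>M(p) (P y) is a combination of the rows with coefficients p_j w_j (x_j . P y),
    and these vanish along with p_j w_j (x_j . P y)^2.\<close>
  then have "info_matrix X w p *v (P *v y) = 0"
    unfolding info_matrix_mult by (intro sum.neutral) auto
  then show "y = 0"
    by (simp add: matrix_vector_mul_assoc P)
qed

text \<open>Keeping only the \<open>i\<close>-th square in the form at y = x_i gives p_i w_i s^2
  \<le> s, and s cancels unless it is 0. Where v_i = d this yields p_i \<le> 1/d.\<close>

lemma variance_mult_le_1:
  assumes P: "info_matrix X w p ** P = mat 1"
    and nonneg: "\<And>j. 0 \<le> p $ j" "\<And>j. 0 < w $ j"
  shows "p $ i * (w $ i * (row i X \<bullet> (P *v row i X))) \<le> 1"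
proof -
  define s where "s = row i X \<bullet> (P *v row i X)"
  have "p $ i * w $ i * s\<^sup>2 \<le> (\<Sum>j\<in>UNIV. p $ j * w $ j * (row j X \<bullet> (P *v row i X))\<^sup>2)"
    unfolding s_def using nonneg
    by (intro member_le_sum[of i UNIV "\<lambda>j. p $ j * w $ j * (row j X \<bullet> (P *v row i X))\<^sup>2"])
       (auto simp: less_imp_le)
  then have "p $ i * w $ i * s\<^sup>2 \<le> s"
    unfolding inverse_info_matrix_form[OF P, symmetric] s_def .
  then have "(p $ i * (w $ i * s)) * s \<le> 1 * s"
    by (simp add: power2_eq_square mult.assoc)
  moreover have "0 \<le> s"
    unfolding s_def using inverse_info_matrix_posdef(1)[OF P nonneg] .
  ultimately show ?thesis
    unfolding s_def[symmetric] by (cases "s = 0") (auto simp: mult_le_cancel_right)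
qed

section \<open>Changing one weight and rescaling the others\<close>

text \<open>The new matrix is c (M(p) + (z/c - p_i) w_i x_i x_i'), a scaled rank-one update. Both
  f_i and a step towards a vertex have this shape.\<close>

lemma objective_coordinate_update:
  fixes X :: "real^'d^'m"
  assumes P: "info_matrix X w p ** P = mat 1" and c: "c \<noteq> 0"
  shows "objective X w (\<chi> j. if j = i then z else c * p $ j)
    = c ^ CARD('d) * objective X w p * (1 + (z / c - p $ i) * (w $ i * (row i X \<bullet> (P *v row i X))))"
proof -
  define s where "s = (z / c - p $ i) * w $ i"
  define u where "u = s *\<^sub>R row i X"
  let ?O = "(\<chi> a b. u $ a * row i X $ b) :: real^'d^'d"
  have "info_matrix X w (\<chi> j. if j = i then z else c * p $ j) = c *\<^sub>R (info_matrix X w p + ?O)"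
  proof -
    have "(\<Sum>j\<in>UNIV. (if j = i then z else c * p $ j) * w $ j * X $ j $ a * X $ j $ b)
      = c * ((\<Sum>j\<in>UNIV. p $ j * w $ j * X $ j $ a * X $ j $ b) + u $ a * row i X $ b)" for a b
    proof -
      have "(\<Sum>j\<in>UNIV. (if j = i then z else c * p $ j) * w $ j * X $ j $ a * X $ j $ b)
        = (\<Sum>j\<in>UNIV. c * (p $ j * w $ j * X $ j $ a * X $ j $ b)
             + (if j = i then c * (u $ a * row i X $ b) else 0))"
        using c by (intro sum.cong) (auto simp: u_def s_def row_def field_simps)
      then show ?thesis
        by (simp add: sum.distrib sum_distrib_left distrib_left)
    qed
    then show ?thesis
      by (simp add: vec_eq_iff info_matrix_component)
  qed
  moreover have "(P *v u) \<bullet> row i X = s * (row i X \<bullet> (P *v row i X))"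
    by (simp add: u_def matrix_vector_mult_scaleR inner_commute)
  ultimately show ?thesis
    by (simp add: objective_eq_det det_scaleR det_add_outer[OF P] s_def mult.assoc)
qed

text \<open>Moving weight t to point \<open>i\<close> multiplies the objective by (1 - t)^d (1 + t v
  / (1 - t)), whose slope at t = 0 is v - d. An explicit t replaces the derivative.\<close>

lemma D_optimal_imp_variance_le:
  fixes X :: "real^'d^'m"
  assumes P: "info_matrix X w p ** P = mat 1" and opt: "D_optimal X w p" and pos: "0 < objective X w p"
  shows "w $ i * (row i X \<bullet> (P *v row i X)) \<le> real CARD('d)"
proof (rule ccontr)
  define v where "v = w $ i * (row i X \<bullet> (P *v row i X))"
  define d where "d = real CARD('d)"
  assume "\<not> ?thesis"
  then have v: "v > d" by (simp add: v_def d_def)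
  have d1: "d \<ge> 1" by (simp add: d_def Suc_leI)
  have alloc: "allocation p" using opt by (simp add: D_optimal_def)
  \<comment> \<open>half the step at which the lower bound \<open>(1 - d t) (1 + t v)\<close> falls back to 1\<close>
  define t where "t = (v - d) / (2 * d * v)"
  have t: "0 < t" "t < 1"
  proof -
    show "0 < t" using v d1 by (simp add: t_def)
    have "v * 1 \<le> v * d" using v d1 by (intro mult_left_mono) auto
    moreover have "2 * d * v = 2 * (v * d)" by simp
    ultimately have "v - d < 2 * d * v" using v d1 by linarith
    then show "t < 1" using v d1 by (simp add: t_def)
  qed
  \<comment> \<open>This is (1 - t) p + t e_i, split by coordinate to match
    \<open>objective_coordinate_update\<close> with c = 1 - t.\<close>
  define q where "q = (\<chi> j. if j = i then t + (1 - t) * p $ i else (1 - t) * p $ j)"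
  have "allocation q"
  proof -
    have "(\<Sum>j\<in>UNIV. q $ j) = (\<Sum>j\<in>UNIV. (1 - t) * p $ j + (if j = i then t else 0))"
      by (intro sum.cong) (auto simp: q_def)
    also have "\<dots> = 1"
      using alloc by (simp add: sum.distrib sum_distrib_left[symmetric] allocation_def)
    finally show ?thesis
      using alloc t by (auto simp: allocation_def q_def)
  qed
  then have "objective X w q \<le> objective X w p"
    using opt by (simp add: D_optimal_def)
  moreover have "objective X w q = (1 - t) ^ CARD('d) * objective X w p * (1 + t / (1 - t) * v)"
  proof -
    have "(t + (1 - t) * p $ i) / (1 - t) - p $ i = t / (1 - t)"
      using t by (simp add: field_simps)
    then show ?thesis
      using objective_coordinate_update[OF P, of "1 - t" i "t + (1 - t) * p $ i"] t
      by (simp add: q_def v_def)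
  qed
  ultimately have le: "(1 - t) ^ CARD('d) * (1 + t / (1 - t) * v) \<le> 1"
    using pos by (simp add: mult_ac)
  \<comment> \<open>Bernoulli for the power and t \<le> t / (1 - t) for the other factor bound the
    gain below by a quadratic in t.\<close>
  have "1 - d * t \<le> (1 - t) ^ CARD('d)"
    using Bernoulli_inequality[of "-t" "CARD('d)"] t by (simp add: d_def)
  moreover have "t \<le> t / (1 - t)" using t by (simp add: field_simps)
  then have "1 + t * v \<le> 1 + t / (1 - t) * v"
    using v d1 by (intro add_left_mono mult_right_mono) auto
  moreover have "d * t = (v - d) / (2 * v)"
    using d1 by (simp add: t_def)
  then have "d * t < 1"
    using v d1 by simp
  ultimately have "(1 - d * t) * (1 + t * v) \<le> (1 - t) ^ CARD('d) * (1 + t / (1 - t) * v)"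
    using t v d1 by (intro mult_mono) auto
  with le have "(1 - d * t) * (1 + t * v) \<le> 1" by simp
  then have "t * (v - d - d * v * t) \<le> 0" by (simp add: algebra_simps)
  then have "v - d \<le> d * v * t" using t by (simp add: mult_le_0_iff)
  also have "d * v * t = (v - d) / 2" using v d1 by (simp add: t_def)
  finally show False using v by simp
qed

section \<open>Existence of a maximizer and the equivalence theorem\<close>

lemma exists_D_optimal:
  fixes X :: "real^'d^'m"
  shows "\<exists>q. D_optimal X w q"
proof -
  let ?S = "{q :: real^'m. allocation q}"
  have "closed ?S"
  proof -
    have "?S = (\<Inter>i. {q. 0 \<le> q $ i}) \<inter> {q. (\<Sum>i\<in>UNIV. q $ i) = 1}"
      by (auto simp: allocation_def)
    also have "closed \<dots>"
      by (intro closed_Int closed_INT ballI closed_Collect_le closed_Collect_eq continuous_intros)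
    finally show ?thesis .
  qed
  moreover have "bounded ?S"
  proof -
    have "norm q \<le> 1" if "allocation q" for q :: "real^'m"
      using norm_le_l1_cart[of q] that by (simp add: allocation_def)
    then show ?thesis by (auto simp: bounded_iff)
  qed
  ultimately have "compact ?S" by (simp add: compact_eq_bounded_closed)
  moreover have "allocation ((\<chi> i. 1 / real CARD('m)) :: real^'m)"
    by (simp add: allocation_def)
  then have "?S \<noteq> {}" by blast
  \<comment> \<open>The Leibniz expansion exhibits the objective as a polynomial in the
    weights.\<close>
  moreover have "continuous_on ?S (objective X w)"
    unfolding objective_eq_det det_def info_matrix_component by (intro continuous_intros)
  ultimately obtain q where "q \<in> ?S" "\<forall>r\<in>?S. objective X w r \<le> objective X w q"
    using continuous_attains_sup by blast
  then show ?thesis by (auto simp: D_optimal_def)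
qed

lemma matrix_diff_ldistrib: "A ** (B - C) = A ** B - A ** (C :: real^'n^'m)"
  by (simp add: matrix_matrix_mult_def vec_eq_iff right_diff_distrib sum_subtractf)

lemma matrix_diff_rdistrib: "(A - B) ** C = A ** C - (B :: real^'n^'m) ** C"
  by (simp add: matrix_matrix_mult_def vec_eq_iff left_diff_distrib sum_subtractf)

text \<open>The trace bounds force a sum of nonnegative terms to be at most 0, so every term
  vanishes. Only the matrices are identified: different allocations can share one.\<close>

lemma info_matrix_eqI:
  fixes X :: "real^'d^'m"
  assumes P: "info_matrix X w p ** P = mat 1" and Q: "info_matrix X w q ** Q = mat 1"
    and p: "\<And>j. 0 \<le> p $ j" and q: "\<And>j. 0 \<le> q $ j" and w: "\<And>j. 0 < w $ j"
    and tr_P: "trace (P ** info_matrix X w q) \<le> real CARD('d)"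
    and tr_Q: "trace (Q ** info_matrix X w p) \<le> real CARD('d)"
  shows "info_matrix X w q = info_matrix X w p"
proof -
  let ?A = "info_matrix X w p" and ?B = "info_matrix X w q"
  define D where "D = ?B - ?A"
  have P': "P ** ?A = mat 1" and Q': "Q ** ?B = mat 1"
    using P Q matrix_left_right_inverse by blast+
  let ?y = "\<lambda>j. D *v (P *v row j X)"
  have D_sym: "(D *v u) \<bullet> v = u \<bullet> (D *v v)" for u v
    by (simp add: D_def matrix_vector_mult_diff_rdistrib inner_diff_left inner_diff_right info_matrix_sym)
  \<comment> \<open>Appending P A = I gives the product the form K M(p) with K = P D Q D P. By
    symmetry of P and D, its trace is then a weighted sum of Q-forms at the vectors D P x_j.\<close>
  have "trace (P ** D ** Q ** D ** P ** ?A) = (\<Sum>j\<in>UNIV. p $ j * w $ j * (?y j \<bullet> (Q *v ?y j)))"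
    unfolding trace_mult_info_matrix
    by (simp add: matrix_vector_mul_assoc[symmetric] inverse_info_matrix_sym[OF P, symmetric] D_sym[symmetric])
  moreover have "trace (P ** D ** Q ** D ** P ** ?A) \<le> 0"
  proof -
    have QD: "Q ** D = mat 1 - Q ** ?A"
      by (simp add: D_def matrix_diff_ldistrib Q')
    have PD: "P ** D = P ** ?B - mat 1"
      by (simp add: D_def matrix_diff_ldistrib P')
    have "P ** D ** Q ** D ** P ** ?A = (P ** D) ** (Q ** D)"
      by (simp add: matrix_mul_assoc[symmetric] P')
    also have "\<dots> = P ** ?B - mat 1 - P ** (?B ** Q) ** ?A + Q ** ?A"
      unfolding QD PD by (simp add: matrix_diff_ldistrib matrix_diff_rdistrib matrix_mul_assoc)
    also have "\<dots> = P ** ?B - mat 1 - mat 1 + Q ** ?A"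
      by (simp add: Q P')
    finally have "trace (P ** D ** Q ** D ** P ** ?A)
        = trace (P ** ?B) - real CARD('d) - real CARD('d) + trace (Q ** ?A)"
      by (simp only: trace_add trace_sub trace_I)
    then show ?thesis
      using tr_P tr_Q by simp
  qed
  moreover have terms: "0 \<le> p $ j * w $ j * (?y j \<bullet> (Q *v ?y j))" for j
    using p[of j] w[of j] inverse_info_matrix_posdef(1)[OF Q q w] by simp
  then have "0 \<le> (\<Sum>j\<in>UNIV. p $ j * w $ j * (?y j \<bullet> (Q *v ?y j)))"
    by (intro sum_nonneg)
  ultimately have "(\<Sum>j\<in>UNIV. p $ j * w $ j * (?y j \<bullet> (Q *v ?y j))) = 0"
    by linarith
  then have zero_terms: "p $ j * w $ j * (?y j \<bullet> (Q *v ?y j)) = 0" for j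
    using terms by (simp add: sum_nonneg_eq_0_iff)
  have y: "p $ j = 0 \<or> ?y j = 0" for j
    using inverse_info_matrix_posdef(2)[OF Q q w, of "?y j"] w[of j] zero_terms[of j] by auto
  \<comment> \<open>Writing u = P (A u) expands D u over the vectors \<open>?y j\<close> with
    coefficients that contain p_j, and p_j or \<open>?y j\<close> is 0.\<close>
  have "D *v u = 0" for u
  proof -
    have "D *v u = D *v (P *v (?A *v u))"
      by (simp only: matrix_vector_mul_assoc[of P] P' matrix_vector_mul_lid)
    also have "\<dots> = (\<Sum>j\<in>UNIV. (p $ j * w $ j * (row j X \<bullet> u)) *\<^sub>R ?y j)"
      by (simp add: info_matrix_mult linear_sum[OF matrix_vector_mul_linear] matrix_vector_mult_scaleR)
    also have "\<dots> = 0"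
      using y by (intro sum.neutral) auto
    finally show ?thesis .
  qed
  then have "D = 0" by (simp add: matrix_eq)
  then show ?thesis by (simp add: D_def)
qed

theorem D_optimal_iff_variance_le:
  fixes X :: "real^'d^'m"
  assumes w: "\<And>i. 0 < w $ i" and alloc: "allocation p" and pos: "0 < objective X w p"
    and P: "info_matrix X w p ** P = mat 1"
  shows "D_optimal X w p \<longleftrightarrow> (\<forall>i. w $ i * (row i X \<bullet> (P *v row i X)) \<le> real CARD('d))"
proof
  assume "D_optimal X w p"
  then show "\<forall>i. w $ i * (row i X \<bullet> (P *v row i X)) \<le> real CARD('d)"
    using D_optimal_imp_variance_le[OF P _ pos] by blast
next
  assume v: "\<forall>i. w $ i * (row i X \<bullet> (P *v row i X)) \<le> real CARD('d)"
  \<comment> \<open>\<open>R\<close> need not be the inverse belonging to \<open>r\<close>: the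
    bound is applied crosswise, to \<open>P\<close> with \<open>q\<close> and to \<open>Q\<close>
    with \<open>p\<close>.\<close>
  have tr: "trace (R ** info_matrix X w r) \<le> real CARD('d)"
    if "allocation r" "\<forall>i. w $ i * (row i X \<bullet> (R *v row i X)) \<le> real CARD('d)" for r R
  proof -
    have "trace (R ** info_matrix X w r) = (\<Sum>j\<in>UNIV. r $ j * (w $ j * (row j X \<bullet> (R *v row j X))))"
      by (simp add: trace_mult_info_matrix mult.assoc)
    also have "\<dots> \<le> (\<Sum>j\<in>UNIV. r $ j * real CARD('d))"
      using that by (intro sum_mono mult_left_mono) (auto simp: allocation_def)
    also have "\<dots> = real CARD('d)"
      using that by (simp add: sum_distrib_right[symmetric] allocation_def)
    finally show ?thesis .
  qed
  obtain q where q: "D_optimal X w q" using exists_D_optimal by blast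
  then have q_alloc: "allocation q" and "objective X w p \<le> objective X w q"
    using alloc by (auto simp: D_optimal_def)
  then have q_pos: "0 < objective X w q" using pos by simp
  then obtain Q where Q: "info_matrix X w q ** Q = mat 1"
    by (metis objective_eq_det invertible_det_nz invertible_right_inverse less_irrefl)
  have "info_matrix X w q = info_matrix X w p"
  proof (rule info_matrix_eqI[OF P Q])
    show "trace (P ** info_matrix X w q) \<le> real CARD('d)" using tr[OF q_alloc v] .
    show "trace (Q ** info_matrix X w p) \<le> real CARD('d)"
      using tr[OF alloc] D_optimal_imp_variance_le[OF Q q q_pos] by blast
  qed (use alloc q_alloc w in \<open>auto simp: allocation_def\<close>)
  \<comment> \<open>Equal information matrices give \<open>p\<close> the same objective value as the
    maximizer \<open>q\<close>.\<close>
  then show "D_optimal X w p"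
    using q alloc by (simp add: D_optimal_def objective_eq_det)
qed

section \<open>From variance bounds to conditions (i) and (ii)\<close>

theorem theorem3p1:
  fixes X :: "real^'d^'m" and w p :: "real^'m"
  assumes "CARD('d) \<ge> 2"
    and "inj (\<lambda>i. row i X)"
    and "\<And>i. 0 < w $ i"
    and "allocation p"
    and "0 < objective X w p"
  shows "D_optimal X w p \<longleftrightarrow>
    (\<forall>i.
      (p $ i = 0 \<and>
        objective_along X w p i (1/2) \<le> (real CARD('d) + 1) / 2 ^ CARD('d) * objective X w p) \<or>
      (0 < p $ i \<and> p $ i \<le> 1 / real CARD('d) \<and>
        objective_along X w p i 0 =
          (1 - p $ i * real CARD('d)) / (1 - p $ i) ^ CARD('d) * objective X w p))"
proof -
  define d where "d = real CARD('d)"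
  have d2: "d \<ge> 2" using assms(1) by (simp add: d_def)
  have p_nonneg: "0 \<le> p $ i" for i using assms(4) by (simp add: allocation_def)
  obtain P where P: "info_matrix X w p ** P = mat 1"
    by (metis assms(5) objective_eq_det invertible_det_nz invertible_right_inverse less_irrefl)
  define v where "v i = w $ i * (row i X \<bullet> (P *v row i X))" for i
  have sum_v: "(\<Sum>i\<in>UNIV. p $ i * v i) = d"
    using sum_variance P matrix_left_right_inverse unfolding v_def d_def by blast
  have along: "objective_along X w p i z = ((1 - z) / (1 - p $ i)) ^ CARD('d) * objective X w p *
      (1 + (z * (1 - p $ i) / (1 - z) - p $ i) * v i)" if "z < 1" "p $ i < 1" for i z
    using objective_coordinate_update[OF P, of "(1 - z) / (1 - p $ i)" i z] that
    by (simp add: objective_along_def v_def)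
  \<comment> \<open>Here c = 1/2 and z/c = 1, so the bracket is 1 + v_i and the constant d + 1
    encodes v_i \<le> d.\<close>
  have half: "objective_along X w p i (1/2) \<le> (d + 1) / 2 ^ CARD('d) * objective X w p \<longleftrightarrow> v i \<le> d"
    if "p $ i = 0" for i
  proof -
    have "objective_along X w p i (1/2) = (v i + 1) / 2 ^ CARD('d) * objective X w p"
      using along[of "1/2" i] that by (simp add: power_divide field_simps)
    then show ?thesis using assms(5) by (simp add: divide_le_cancel)
  qed
  \<comment> \<open>At z = 0 the bracket is 1 - p_i v_i; since p_i > 0, it determines v_i.\<close>
  have zero: "objective_along X w p i 0 = (1 - p $ i * d) / (1 - p $ i) ^ CARD('d) * objective X w p
      \<longleftrightarrow> v i = d" if "0 < p $ i" "p $ i < 1" for i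
  proof -
    have "objective_along X w p i 0 = (1 - p $ i * v i) / (1 - p $ i) ^ CARD('d) * objective X w p"
      using along[of 0 i] that by (simp add: power_divide)
    then show ?thesis using assms(5) that by (simp add: divide_cancel_right)
  qed
  \<comment> \<open>With p_i \<le> 1/d this supplies p_i < 1, which \<open>zero\<close>
    requires.\<close>
  have d_inv: "1 / d < 1" using d2 by simp
  have "(\<forall>i. v i \<le> d) \<longleftrightarrow> (\<forall>i.
      (p $ i = 0 \<and> v i \<le> d) \<or> (0 < p $ i \<and> p $ i \<le> 1 / d \<and> v i = d))"
  proof (intro iffI allI)
    fix i
    assume v: "\<forall>i. v i \<le> d"
    \<comment> \<open>Complementary slackness: the nonnegative slacks d - v_j have weighted sum
      0.\<close>
    have "(\<Sum>j\<in>UNIV. p $ j * (d - v j)) = (\<Sum>j\<in>UNIV. p $ j) * d - d"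
      by (simp add: right_diff_distrib sum_subtractf sum_v sum_distrib_right)
    then have "(\<Sum>j\<in>UNIV. p $ j * (d - v j)) = 0"
      using assms(4) by (simp add: allocation_def)
    then have "p $ i * (d - v i) = 0"
      using v p_nonneg by (simp add: sum_nonneg_eq_0_iff)
    moreover have "p $ i * v i \<le> 1"
      unfolding v_def using variance_mult_le_1[OF P p_nonneg assms(3)] .
    ultimately show "(p $ i = 0 \<and> v i \<le> d) \<or> (0 < p $ i \<and> p $ i \<le> 1 / d \<and> v i = d)"
      using v p_nonneg[of i] d2 by (auto simp: field_simps)
  qed (metis order_refl)
  also have "\<dots> \<longleftrightarrow> (\<forall>i.
      (p $ i = 0 \<and> objective_along X w p i (1/2) \<le> (d + 1) / 2 ^ CARD('d) * objective X w p) \<or>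
      (0 < p $ i \<and> p $ i \<le> 1 / d \<and>
        objective_along X w p i 0 = (1 - p $ i * d) / (1 - p $ i) ^ CARD('d) * objective X w p))"
    using half zero[symmetric] d_inv by (intro all_cong1 arg_cong2[of _ _ _ _ "(\<or>)"] conj_cong refl) auto
  finally show ?thesis
    using D_optimal_iff_variance_le[OF assms(3,4,5) P] by (simp add: v_def d_def)
qed

end
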